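(* Let $\lambda$ be an essentially regular point of $(\mathcal A,F)$ and let $H_{r_\lambda}\in\mathcal A$ be an operator resonant at $\lambda$. Then the vector space $$\Upsilon^1_{\lambda+i0}(r_\lambda)=\Upsilon^1_\lambda(H_{r_\lambda},V)$$ does not depend on the regularizing operator $V$; that is, for any two regularizing directions $V,V'\in\mathcal A_0(F)$ for $H_{r_\lambda}$ at $\lambda$ one has $\Upsilon^1_\lambda(H_{r_\lambda},V)=\Upsilon^1_\lambda(H_{r_\lambda},V')$.
   Context: Setting. $\mathcal H,\mathcal K$ are complex separable Hilbert spaces. $F:\mathcal H\to\mathcal K$ is a closed densely defined operator with trivial kernel and co-kernel (the rigging operator). $\mathcal A_0(F)$ is a real vector space of self-adjoint operators $V$ on $\mathcal H$ of the form $V=F^*JF$, where $J$ runs over a real subspace of the bounded self-adjoint operators on $\mathcal K$, and $\mathcal A=H+\mathcal A_0(F)$ is an affine space of self-adjoint operators on $\mathcal H$. Write $R_z(H)=(H-z)^{-1}$. Standing assumptions: all $H\in\mathcal A$ have a common dense domain $\mathcal D$; $\mathcal D\subset\operatorname{dom}(F)$ and $\mathcal D\subset\operatorname{dom}(V)$ for all $V\in\mathcal A_0(F)$; every $V\in\mathcal A_0(F)$ is relatively compact with respect to every $H\in\mathcal A$; and for non-real $z$ the operator $T_z(H):=FR_z(H)F^*$ (densely defined on $\operatorname{dom}F^*$) extends to a compact operator on $\mathcal K$, also denoted $T_z(H)$. $\Lambda(H,F)$ is the set of real $\lambda$ for which the norm limit $T_{\lambda+i0}(H):=\lim_{y\to0^+}T_{\lambda+iy}(H)$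 exists; it is assumed to have full Lebesgue measure for every $H\in\mathcal A$. Elements of $\bigcup_{H\in\mathcal A}\Lambda(H,F)$ are called essentially regular points of $(\mathcal A,F)$. For an essentially regular $\lambda$, $H\in\mathcal A$ is regular at $\lambda$ if $\lambda\in\Lambda(H,F)$ and resonant at $\lambda$ otherwise. If $H\in\mathcal A$ is resonant at $\lambda$, then $V\in\mathcal A_0(F)$ is a regularizing direction (regularizing operator) for $H$ at $\lambda$ if $H+tV$ is regular at $\lambda$ for some real $t$. For a regularizing direction $V=F^*JF$, $$\Upsilon^1_\lambda(H,V):=\{u\in\mathcal K:\ (1-tT_{\lambda+i0}(H+tV)J)u=0\},$$ where $t$ is any real number such that $H+tV$ is regular at $\lambda$; this does not depend on the choice of $t$. (Writing $H=H_{r_\lambda}$, $H_s=H_{r_\lambda}+(s-r_\lambda)V$, this is the space of solutions of $(1+(r_\lambda-s)T_{\lambda+i0}(H_s)J)u=0$.) *)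

theory Defs
  imports "HOL-Analysis.Analysis"
begin

section \<open>Complex Hilbert spaces\<close>

text \<open>
  Completeness is added by the library class \<open>complete_space\<close>. The norm, the topology
  and the type of bounded operators (\<open>'a \<Rightarrow>\<^sub>L 'b\<close>, real-linear a priori) are those of the
  underlying real inner product space; since \<open>Re (cinner x x) = x \<bullet> x\<close>, the norm is the
  Hilbert space norm, and the operator norm is the usual one. The inner product is conjugate
  linear in the first argument.
\<close>

class complex_inner = real_inner +
  fixes scaleC :: "complex \<Rightarrow> 'a \<Rightarrow> 'a" (infixr "*\<^sub>C" 75)
    and cinner :: "'a \<Rightarrow> 'a \<Rightarrow> complex"
  assumes scaleC_add_right: "c *\<^sub>C (x + y) = c *\<^sub>C x + c *\<^sub>C y"
    and scaleC_add_left: "(c + d) *\<^sub>C x = c *\<^sub>C x + d *\<^sub>C x"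
    and scaleC_scaleC: "c *\<^sub>C d *\<^sub>C x = (c * d) *\<^sub>C x"
    and scaleC_of_real: "complex_of_real r *\<^sub>C x = r *\<^sub>R x"
    and cinner_commute: "cinner x y = cnj (cinner y x)"
    and cinner_add_left: "cinner (x + y) z = cinner x z + cinner y z"
    and cinner_scaleC_left: "cinner (c *\<^sub>C x) y = cnj c * cinner x y"
    and Re_cinner: "Re (cinner x y) = x \<bullet> y"

class complex_hilbert_space = complex_inner + complete_space

definition clinear_blinfun :: "('a::complex_inner \<Rightarrow>\<^sub>L 'b::complex_inner) \<Rightarrow> bool" where
  "clinear_blinfun A \<longleftrightarrow> (\<forall>c x. A (c *\<^sub>C x) = c *\<^sub>C A x)"

definition compact_blinfun :: "('a::complex_inner \<Rightarrow>\<^sub>L 'b::complex_inner) \<Rightarrow> bool" where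
  "compact_blinfun A \<longleftrightarrow> clinear_blinfun A \<and> (\<forall>S. bounded S \<longrightarrow> compact (closure (A ` S)))"

definition selfadjoint_blinfun :: "('a::complex_inner \<Rightarrow>\<^sub>L 'a) \<Rightarrow> bool" where
  "selfadjoint_blinfun A \<longleftrightarrow> clinear_blinfun A \<and> (\<forall>x y. cinner (A x) y = cinner x (A y))"


section \<open>Unbounded operators\<close>

text \<open>
  An unbounded operator is identified with its graph, so that \<open>Domain\<close> is its domain, equality
  includes equality of domains, \<open>\<subseteq>\<close> is extension of operators, and relational composition
  \<open>S O T\<close> (in diagrammatic order) is the operator product \<open>TS\<close> on its natural domain.
\<close>

type_synonym ('a, 'b) uop = "('a \<times> 'b) set"

definition linear_op :: "('a::complex_inner, 'b::complex_inner) uop \<Rightarrow> bool" where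
  "linear_op T \<longleftrightarrow> single_valued T \<and> (0, 0) \<in> T
     \<and> (\<forall>x y x' y'. (x, y) \<in> T \<longrightarrow> (x', y') \<in> T \<longrightarrow> (x + x', y + y') \<in> T)
     \<and> (\<forall>c x y. (x, y) \<in> T \<longrightarrow> (c *\<^sub>C x, c *\<^sub>C y) \<in> T)"

definition densely_defined :: "('a::complex_inner, 'b::complex_inner) uop \<Rightarrow> bool" where
  "densely_defined T \<longleftrightarrow> closure (Domain T) = UNIV"

definition op_kernel :: "('a::complex_inner, 'b::complex_inner) uop \<Rightarrow> 'a set" where
  "op_kernel T = {x. (x, 0) \<in> T}"

definition op_adjoint :: "('a::complex_inner, 'b::complex_inner) uop \<Rightarrow> ('b, 'a) uop" where
  "op_adjoint T = {(y, w). \<forall>(x, v) \<in> T. cinner y v = cinner w x}"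

definition selfadjoint_op :: "('a::complex_inner, 'a) uop \<Rightarrow> bool" where
  "selfadjoint_op T \<longleftrightarrow> linear_op T \<and> densely_defined T \<and> op_adjoint T = T"

definition op_add :: "('a::complex_inner, 'b::complex_inner) uop \<Rightarrow> ('a, 'b) uop \<Rightarrow> ('a, 'b) uop"
  where "op_add S T = {(x, y + z) | x y z. (x, y) \<in> S \<and> (x, z) \<in> T}"

definition op_scaleR :: "real \<Rightarrow> ('a::complex_inner, 'b::complex_inner) uop \<Rightarrow> ('a, 'b) uop" where
  "op_scaleR t T = {(x, t *\<^sub>R y) | x y. (x, y) \<in> T}"

definition op_of :: "('a::complex_inner \<Rightarrow>\<^sub>L 'b::complex_inner) \<Rightarrow> ('a, 'b) uop" where
  "op_of A = {(x, A x) | x. True}"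

definition op_resolvent :: "('a::complex_inner, 'a) uop \<Rightarrow> complex \<Rightarrow> ('a, 'a) uop" where
  "op_resolvent H z = {(y - z *\<^sub>C x, x) | x y. (x, y) \<in> H}"

definition resolvent_set :: "('a::complex_inner, 'a) uop \<Rightarrow> complex set" where
  "resolvent_set H = {z. \<exists>R. clinear_blinfun R \<and> op_resolvent H z = op_of R}"

definition relatively_compact :: "('a::complex_inner, 'b::complex_inner) uop \<Rightarrow> ('a, 'a) uop \<Rightarrow> bool"
  where "relatively_compact V H \<longleftrightarrow> Domain H \<subseteq> Domain V
     \<and> (\<exists>z \<in> resolvent_set H. \<exists>K. compact_blinfun K \<and> op_resolvent H z O V = op_of K)"


section \<open>Operators on a rigged Hilbert space\<close>

definition rigged_product :: "('h::complex_inner, 'k::complex_inner) uop \<Rightarrow> ('k \<Rightarrow>\<^sub>L 'k) \<Rightarrow> ('h, 'h) uop"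
  where "rigged_product F J = F O op_of J O op_adjoint F"

text \<open>
  The self-adjoint operator \<open>V = F\<^sup>*JF\<close>. If the product on its natural domain is self-adjoint, it is
  closed and the closure below changes nothing. Without the closure, a vector space of such
  operators could exist for bounded \<open>F\<close> only: for \<open>J = 0\<close> the natural domain is \<open>dom F\<close>, and
  the zero operator on \<open>dom F\<close> is self-adjoint only if \<open>dom F\<close> is the whole space.
\<close>

definition rigged_op :: "('h::complex_inner, 'k::complex_inner) uop \<Rightarrow> ('k \<Rightarrow>\<^sub>L 'k) \<Rightarrow> ('h, 'h) uop"
  where "rigged_op F J = closure (rigged_product F J)"

definition sandwiched_resolvent_pre ::
    "('h::complex_inner, 'k::complex_inner) uop \<Rightarrow> ('h, 'h) uop \<Rightarrow> complex \<Rightarrow> ('k, 'k) uop" where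
  "sandwiched_resolvent_pre F H z = op_adjoint F O op_resolvent H z O F"

text \<open>\<open>T\<^sub>z(H)\<close>, the bounded extension of the densely defined operator \<open>F R\<^sub>z(H) F\<^sup>*\<close>.\<close>

definition sandwiched_resolvent ::
    "('h::complex_inner, 'k::complex_inner) uop \<Rightarrow> ('h, 'h) uop \<Rightarrow> complex \<Rightarrow> ('k \<Rightarrow>\<^sub>L 'k)" where
  "sandwiched_resolvent F H z = (THE K. sandwiched_resolvent_pre F H z \<subseteq> op_of K)"

text \<open>\<open>\<Lambda>(H, F)\<close> and \<open>T\<^sub>\<lambda>\<^sub>+\<^sub>i\<^sub>0(H)\<close>; limits are taken in the operator norm.\<close>

definition regular_points :: "('h::complex_inner, 'k::complex_inner) uop \<Rightarrow> ('h, 'h) uop \<Rightarrow> real set"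
  where "regular_points F H =
    {l. \<exists>L. ((\<lambda>y. sandwiched_resolvent F H (Complex l y)) \<longlongrightarrow> L) (at_right 0)}"

definition sandwiched_resolvent_limit ::
    "('h::complex_inner, 'k::complex_inner) uop \<Rightarrow> ('h, 'h) uop \<Rightarrow> real \<Rightarrow> ('k \<Rightarrow>\<^sub>L 'k)" where
  "sandwiched_resolvent_limit F H l =
    Lim (at_right 0) (\<lambda>y. sandwiched_resolvent F H (Complex l y))"

definition perturbation_space ::
    "('h::complex_inner, 'k::complex_inner) uop \<Rightarrow> ('k \<Rightarrow>\<^sub>L 'k) set \<Rightarrow> ('h, 'h) uop set" where
  "perturbation_space F \<J> = rigged_op F ` \<J>"

definition affine_op_space ::
    "('h::complex_inner, 'k::complex_inner) uop \<Rightarrow> ('k \<Rightarrow>\<^sub>L 'k) set \<Rightarrow> ('h, 'h) uop \<Rightarrow> ('h, 'h) uop set"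
  where "affine_op_space F \<J> H0 = op_add H0 ` perturbation_space F \<J>"

text \<open>
  Trivial co-kernel means that the orthogonal complement of the range of \<open>F\<close>, which is the kernel
  of \<open>F\<^sup>*\<close>, is zero. In \<open>domain_subset\<close>, the domain of \<open>V = F\<^sup>*JF\<close> is that of the operator product,
  so that each \<open>V\<close> acts on \<open>\<D>\<close> as \<open>F\<^sup>*JF\<close>.
\<close>

locale rigged_affine_space =
  fixes F :: "('h::complex_hilbert_space, 'k::complex_hilbert_space) uop"
    and \<J> :: "('k \<Rightarrow>\<^sub>L 'k) set"
    and H0 :: "('h, 'h) uop"
    and \<D> :: "'h set"
  assumes separable_H: "\<exists>S::'h set. countable S \<and> closure S = UNIV"
    and separable_K: "\<exists>S::'k set. countable S \<and> closure S = UNIV"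
    and F_linear: "linear_op F"
    and F_closed: "closed F"
    and F_dense: "densely_defined F"
    and F_kernel: "op_kernel F = {0}"
    and F_cokernel: "op_kernel (op_adjoint F) = {0}"
    and J_subspace: "subspace \<J>"
    and J_selfadjoint: "J \<in> \<J> \<Longrightarrow> selfadjoint_blinfun J"
    and V_selfadjoint: "V \<in> perturbation_space F \<J> \<Longrightarrow> selfadjoint_op V"
    and H_selfadjoint: "H \<in> affine_op_space F \<J> H0 \<Longrightarrow> selfadjoint_op H"
    and domain_dense: "closure \<D> = UNIV"
    and common_domain: "H \<in> affine_op_space F \<J> H0 \<Longrightarrow> Domain H = \<D>"
    and domain_subset_F: "\<D> \<subseteq> Domain F"
    and domain_subset: "J \<in> \<J> \<Longrightarrow> \<D> \<subseteq> Domain (rigged_product F J)"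
    and V_relatively_compact:
      "V \<in> perturbation_space F \<J> \<Longrightarrow> H \<in> affine_op_space F \<J> H0 \<Longrightarrow> relatively_compact V H"
    and T_compact:
      "H \<in> affine_op_space F \<J> H0 \<Longrightarrow> Im z \<noteq> 0 \<Longrightarrow>
        \<exists>K. compact_blinfun K \<and> sandwiched_resolvent_pre F H z \<subseteq> op_of K"
    and regular_full_measure:
      "H \<in> affine_op_space F \<J> H0 \<Longrightarrow> AE l in lebesgue. l \<in> regular_points F H"

definition essentially_regular_points ::
    "('h::complex_inner, 'k::complex_inner) uop \<Rightarrow> ('k \<Rightarrow>\<^sub>L 'k) set \<Rightarrow> ('h, 'h) uop \<Rightarrow> real set" where
  "essentially_regular_points F \<J> H0 = (\<Union>H \<in> affine_op_space F \<J> H0. regular_points F H)"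

definition regular_at ::
    "('h::complex_inner, 'k::complex_inner) uop \<Rightarrow> ('h, 'h) uop \<Rightarrow> real \<Rightarrow> bool" where
  "regular_at F H l \<longleftrightarrow> l \<in> regular_points F H"

definition resonant_at ::
    "('h::complex_inner, 'k::complex_inner) uop \<Rightarrow> ('h, 'h) uop \<Rightarrow> real \<Rightarrow> bool" where
  "resonant_at F H l \<longleftrightarrow> \<not> regular_at F H l"

definition regularizing_direction ::
    "('h::complex_inner, 'k::complex_inner) uop \<Rightarrow> ('h, 'h) uop \<Rightarrow> real \<Rightarrow> ('h, 'h) uop \<Rightarrow> bool" where
  "regularizing_direction F H l V \<longleftrightarrow> (\<exists>t. regular_at F (op_add H (op_scaleR t V)) l)"

text \<open>
  \<open>\<Upsilon>\<^sup>1\<^sub>\<lambda>(H, V)\<close> for \<open>V = F\<^sup>*JF\<close>, computed with the given \<open>J\<close> and with a given real \<open>t\<close> for which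
  \<open>H + tV\<close> is regular at \<open>\<lambda>\<close>. Independence of these two choices is a property of
  \<open>\<Upsilon>\<^sup>1\<close>, not built into the definition.
\<close>

definition Upsilon1 ::
    "('h::complex_inner, 'k::complex_inner) uop \<Rightarrow> real \<Rightarrow> ('h, 'h) uop \<Rightarrow> ('k \<Rightarrow>\<^sub>L 'k) \<Rightarrow> real \<Rightarrow> 'k set"
  where "Upsilon1 F l H J t =
    {u. u - t *\<^sub>R sandwiched_resolvent_limit F (op_add H (op_scaleR t (rigged_op F J))) l (J u) = 0}"

end

theory Submission
  imports Defs
begin

text \<open>
  Put \<open>H\<^sub>1 = H + tV\<close>, \<open>H\<^sub>2 = H + t'V'\<close> and \<open>C = t'J' - tJ\<close>, so that \<open>H\<^sub>2 - H\<^sub>1 = F\<^sup>*CF\<close> on the common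
  domain. The second resolvent identity, sandwiched between \<open>F\<close> and \<open>F\<^sup>*\<close>, reads
  \<open>T\<^sub>z(H\<^sub>1) - T\<^sub>z(H\<^sub>2) = T\<^sub>z(H\<^sub>2) C T\<^sub>z(H\<^sub>1)\<close> on the dense domain of \<open>F\<^sup>*\<close>, hence everywhere, and it survives the
  limit \<open>z \<rightarrow> \<lambda> + i0\<close>. Applied to \<open>tJu\<close> with \<open>u = tT\<^sub>\<lambda>\<^sub>+\<^sub>i\<^sub>0(H\<^sub>1)Ju\<close>, it gives \<open>u = t'T\<^sub>\<lambda>\<^sub>+\<^sub>i\<^sub>0(H\<^sub>2)J'u\<close>.
\<close>

section \<open>Orthogonal projection in real Hilbert spaces\<close>

lemma closest_point_exists:
  fixes S :: "'a::{real_inner, complete_space} set"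
  assumes "closed S" "convex S" "S \<noteq> {}"
  obtains p where "p \<in> S" "\<And>s. s \<in> S \<Longrightarrow> dist x p \<le> dist x s"
proof -
  define d where "d = infdist x S"
  have d_le: "d \<le> dist x s" if "s \<in> S" for s
    using that unfolding d_def by (rule infdist_le)
  have "0 \<le> d" unfolding d_def by (rule infdist_nonneg)
  \<comment> \<open>A minimizing sequence, with its error measured on squared distances, the
    quantities that the parallelogram law compares.\<close>
  have "\<exists>s\<in>S. (dist x s)\<^sup>2 < d\<^sup>2 + 1 / real (Suc n)" for n
  proof -
    have "d < sqrt (d\<^sup>2 + 1 / real (Suc n))"
      using \<open>0 \<le> d\<close> by (intro real_less_rsqrt) auto
    then obtain s where "s \<in> S" "dist x s < sqrt (d\<^sup>2 + 1 / real (Suc n))"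
      using cInf_lessD[of "dist x ` S"] assms(3) unfolding d_def infdist_notempty[OF assms(3)] by blast
    moreover from this have "(dist x s)\<^sup>2 < (sqrt (d\<^sup>2 + 1 / real (Suc n)))\<^sup>2"
      by (intro power_strict_mono) auto
    ultimately show ?thesis by (auto simp: real_sqrt_pow2)
  qed
  then obtain s where s: "\<And>n. s n \<in> S" "\<And>n. (dist x (s n))\<^sup>2 < d\<^sup>2 + 1 / real (Suc n)"
    by metis
  have parallelogram: "(dist a b)\<^sup>2 \<le> 2 * (dist x a)\<^sup>2 + 2 * (dist x b)\<^sup>2 - 4 * d\<^sup>2"
    if "a \<in> S" "b \<in> S" for a b
  proof -
    \<comment> \<open>The midpoint stays in \<open>S\<close> by convexity, so its distance to
      \<open>x\<close> is at least \<open>d\<close>; the parallelogram law turns this into a bound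
      on \<open>dist a b\<close>.\<close>
    have "(1/2) *\<^sub>R a + (1/2) *\<^sub>R b \<in> S"
      using assms(2) that by (intro convexD) auto
    then have "d\<^sup>2 \<le> (dist x ((1/2) *\<^sub>R a + (1/2) *\<^sub>R b))\<^sup>2"
      using \<open>0 \<le> d\<close> d_le by (intro power_mono) auto
    moreover have "(dist a b)\<^sup>2 + 4 * (dist x ((1/2) *\<^sub>R a + (1/2) *\<^sub>R b))\<^sup>2
        = 2 * (dist x a)\<^sup>2 + 2 * (dist x b)\<^sup>2"
      by (simp add: dist_norm power2_norm_eq_inner inner_commute algebra_simps)
    ultimately show ?thesis by linarith
  qed
  have "Cauchy s"
  proof (rule metric_CauchyI)
    fix e :: real assume "0 < e"
    \<comment> \<open>The terms in \<open>d\<close> cancel in the parallelogram bound and leave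
      twice the sum of the two errors, at most four times \<open>inverse (real (Suc N))\<close>;
      hence the quarter.\<close>
    then obtain N where N: "inverse (real (Suc N)) < e\<^sup>2 / 4"
      using reals_Archimedean[of "e\<^sup>2 / 4"] by auto
    have "dist (s m) (s n) < e" if "N \<le> m" "N \<le> n" for m n
    proof -
      have "1 / real (Suc m) \<le> inverse (real (Suc N))" "1 / real (Suc n) \<le> inverse (real (Suc N))"
        using that by (auto simp: field_simps)
      then have "(dist (s m) (s n))\<^sup>2 < e\<^sup>2"
        using parallelogram[OF s(1) s(1), of m n] s(2)[of m] s(2)[of n] N by linarith
      then show ?thesis using \<open>0 < e\<close> by (intro power2_less_imp_less[of _ e]) auto
    qed
    then show "\<exists>M. \<forall>m\<ge>M. \<forall>n\<ge>M. dist (s m) (s n) < e" by blast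
  qed
  then obtain p where p: "s \<longlonglongrightarrow> p"
    using Cauchy_convergent convergent_def by blast
  have "(dist x p)\<^sup>2 \<le> d\<^sup>2"
  proof (rule LIMSEQ_le)
    show "(\<lambda>n. (dist x (s n))\<^sup>2) \<longlonglongrightarrow> (dist x p)\<^sup>2" by (intro tendsto_intros p)
    show "(\<lambda>n. d\<^sup>2 + 1 / real (Suc n)) \<longlonglongrightarrow> d\<^sup>2"
      using LIMSEQ_inverse_real_of_nat_add[of "d\<^sup>2"] by (simp add: inverse_eq_divide)
    show "\<exists>N. \<forall>n\<ge>N. (dist x (s n))\<^sup>2 \<le> d\<^sup>2 + 1 / real (Suc n)"
      using s(2) less_imp_le by blast
  qed
  then have "dist x p \<le> d" using \<open>0 \<le> d\<close> by (rule power2_le_imp_le)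
  then have "dist x p \<le> dist x s" if "s \<in> S" for s using d_le[OF that] by linarith
  moreover have "p \<in> S" using assms(1) s(1) p by (rule closed_sequentially)
  ultimately show thesis using that by blast
qed

text \<open>The witness is \<open>x - p\<close>, with \<open>p\<close> the point of \<open>S\<close>
  closest to \<open>x\<close>: the variational inequality at \<open>p\<close>, used for
  \<open>s\<close> and for \<open>- s\<close>, makes it orthogonal to \<open>S\<close>. Real
  orthogonality is enough, and the lemma serves both for ranges of operators and for graphs in a
  product space.\<close>

lemma orthogonal_separation:
  fixes S :: "'a::{real_inner, complete_space} set"
  assumes "closed S" "subspace S" "x \<notin> S"
  obtains y where "\<And>s. s \<in> S \<Longrightarrow> y \<bullet> s = 0" "y \<bullet> x \<noteq> 0"
proof -
  obtain p where p: "p \<in> S" "\<And>s. s \<in> S \<Longrightarrow> dist x p \<le> dist x s"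
    using closest_point_exists[OF assms(1) subspace_imp_convex[OF assms(2)]] subspace_0[OF assms(2)]
    by (metis empty_iff)
  have le: "(x - p) \<bullet> s \<le> 0" if "s \<in> S" for s
    using any_closest_point_dot[of S p "p + s" x] p that assms(1,2)
    by (auto simp: subspace_imp_convex subspace_add)
  have orth: "(x - p) \<bullet> s = 0" if "s \<in> S" for s
    using le[OF that] le[OF subspace_neg[OF assms(2) that]] by simp
  have "(x - p) \<bullet> x = (x - p) \<bullet> (x - p)"
    using orth[OF p(1)] by (simp add: inner_diff_right)
  moreover have "x \<noteq> p" using p(1) assms(3) by auto
  ultimately have "(x - p) \<bullet> x \<noteq> 0" by simp
  with orth show thesis by (rule that)
qed

lemma subspace_closure:
  fixes S :: "'a::real_normed_vector set"
  assumes "subspace S"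
  shows "subspace (closure S)"
proof (rule subspaceI)
  show "0 \<in> closure S" using subspace_0[OF assms] closure_subset by blast
next
  fix x y assume "x \<in> closure S" "y \<in> closure S"
  then obtain f g where "\<And>n. f n \<in> S" "f \<longlonglongrightarrow> x" "\<And>n. g n \<in> S" "g \<longlonglongrightarrow> y"
    unfolding closure_sequential by blast
  then have "\<And>n. f n + g n \<in> S" "(\<lambda>n. f n + g n) \<longlonglongrightarrow> x + y"
    using subspace_add[OF assms] by (auto intro: tendsto_add)
  then show "x + y \<in> closure S"
    unfolding closure_sequential by (intro exI[of _ "\<lambda>n. f n + g n"]) auto
next
  fix c x assume "x \<in> closure S"
  then obtain f where "\<And>n. f n \<in> S" "f \<longlonglongrightarrow> x"
    unfolding closure_sequential by blast
  then have "\<And>n. c *\<^sub>R f n \<in> S" "(\<lambda>n. c *\<^sub>R f n) \<longlonglongrightarrow> c *\<^sub>R x"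
    using subspace_scale[OF assms] by (auto intro: tendsto_scaleR)
  then show "c *\<^sub>R x \<in> closure S"
    unfolding closure_sequential by (intro exI[of _ "\<lambda>n. c *\<^sub>R f n"]) auto
qed

lemma subspace_dense_if_orthogonal_zero:
  fixes S :: "'a::{real_inner, complete_space} set"
  assumes "subspace S" "\<And>y. (\<And>s. s \<in> S \<Longrightarrow> y \<bullet> s = 0) \<Longrightarrow> y = 0"
  shows "closure S = UNIV"
proof (rule ccontr)
  assume "closure S \<noteq> UNIV"
  then obtain x where x: "x \<notin> closure S" by blast
  have "closed (closure S)" by simp
  moreover have "subspace (closure S)" using assms(1) by (rule subspace_closure)
  ultimately obtain y where "\<And>s. s \<in> closure S \<Longrightarrow> y \<bullet> s = 0" "y \<bullet> x \<noteq> 0"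
    using x orthogonal_separation by metis
  then show False
    using assms(2)[of y] closure_subset[of S] by (metis inner_zero_left subsetD)
qed

section \<open>The complex structure in terms of the real inner product\<close>

lemma inner_scaleC: "x \<bullet> (c *\<^sub>C y) = (cnj c *\<^sub>C x) \<bullet> (y::'a::complex_inner)"
  by (metis Re_cinner cinner_commute cinner_scaleC_left complex_cnj_cnj complex_cnj_mult inner_commute cnj.simps(1))

lemma Im_cinner: "Im (cinner x y) = - ((x::'a::complex_inner) \<bullet> (\<i> *\<^sub>C y))"
proof -
  have "x \<bullet> (\<i> *\<^sub>C y) = Re (cinner (\<i> *\<^sub>C y) x)" by (simp add: Re_cinner inner_commute)
  also have "\<dots> = - Im (cinner x y)"
    by (subst cinner_commute[of x y]) (simp add: cinner_scaleC_left)
  finally show ?thesis by simp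
qed

lemma scaleC_complex: "c *\<^sub>C x = Re c *\<^sub>R x + Im c *\<^sub>R (\<i> *\<^sub>C (x::'a::complex_inner))"
proof -
  have "c *\<^sub>C x = (complex_of_real (Re c) + complex_of_real (Im c) * \<i>) *\<^sub>C x"
    using complex_eq[of c] by (simp add: mult.commute)
  also have "\<dots> = Re c *\<^sub>R x + Im c *\<^sub>R (\<i> *\<^sub>C x)"
    by (simp only: scaleC_add_left flip: scaleC_scaleC scaleC_of_real)
  finally show ?thesis .
qed

lemma scaleC_diff_right: "c *\<^sub>C (x - y) = c *\<^sub>C x - c *\<^sub>C (y::'a::complex_inner)"
  by (metis add_diff_cancel diff_add_cancel scaleC_add_right)

lemma scaleC_scaleR: "c *\<^sub>C r *\<^sub>R x = r *\<^sub>R c *\<^sub>C (x::'a::complex_inner)"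
  by (simp add: scaleC_scaleC mult.commute flip: scaleC_of_real)

lemma norm_scaleC_i: "norm (\<i> *\<^sub>C (x::'a::complex_inner)) = norm x"
proof -
  have "\<i> *\<^sub>C x \<bullet> \<i> *\<^sub>C x = x \<bullet> x"
    by (simp add: inner_scaleC scaleC_scaleC scaleC_of_real[of 1, simplified])
  then show ?thesis by (simp add: norm_eq_sqrt_inner)
qed

text \<open>Multiplication by the imaginary unit is an isometry, and any complex scalar is a real
  combination of 1 and that unit.\<close>

lemma tendsto_scaleC [tendsto_intros]:
  fixes f :: "'b \<Rightarrow> 'a::complex_inner"
  assumes "(f \<longlongrightarrow> l) A"
  shows "((\<lambda>n. c *\<^sub>C f n) \<longlongrightarrow> c *\<^sub>C l) A"
proof -
  have "((\<lambda>n. \<i> *\<^sub>C f n) \<longlongrightarrow> \<i> *\<^sub>C l) A"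
    using assms unfolding tendsto_iff dist_norm
    by (simp add: norm_scaleC_i flip: scaleC_diff_right)
  then show ?thesis
    unfolding scaleC_complex[of c] by (intro tendsto_intros assms)
qed

section \<open>Graphs of linear operators and their adjoints\<close>

lemma linear_op_subspace: "linear_op T \<Longrightarrow> subspace T"
  unfolding linear_op_def subspace_def by (auto simp: zero_prod_def simp flip: scaleC_of_real)

lemma linear_op_diff:
  "linear_op T \<Longrightarrow> (x, y) \<in> T \<Longrightarrow> (x', y') \<in> T \<Longrightarrow> (x - x', y - y') \<in> T"
  using subspace_diff[OF linear_op_subspace] by fastforce

text \<open>The graph of \<open>T\<close> is invariant under multiplication by the imaginary unit,
  so the real identity at the rotated pair supplies the imaginary part. Adjoints can then be handled
  by real orthogonality alone.\<close>

lemma op_adjoint_iff_inner: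
  assumes "linear_op T"
  shows "(y, w) \<in> op_adjoint T \<longleftrightarrow> (\<forall>(x, v) \<in> T. y \<bullet> v = w \<bullet> x)"
proof
  assume "(y, w) \<in> op_adjoint T"
  then show "\<forall>(x, v) \<in> T. y \<bullet> v = w \<bullet> x"
    unfolding op_adjoint_def by (auto simp flip: Re_cinner)
next
  assume *: "\<forall>(x, v) \<in> T. y \<bullet> v = w \<bullet> x"
  have "cinner y v = cinner w x" if "(x, v) \<in> T" for x v
  proof (rule complex_eqI)
    show "Re (cinner y v) = Re (cinner w x)" using * that by (auto simp: Re_cinner)
    have "(\<i> *\<^sub>C x, \<i> *\<^sub>C v) \<in> T" using assms that unfolding linear_op_def by blast
    then show "Im (cinner y v) = Im (cinner w x)" using * by (auto simp: Im_cinner)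
  qed
  then show "(y, w) \<in> op_adjoint T" unfolding op_adjoint_def by auto
qed

lemma subspace_op_adjoint:
  assumes "linear_op T"
  shows "subspace (op_adjoint T)"
proof (rule subspaceI)
  show "0 \<in> op_adjoint T" by (auto simp: zero_prod_def op_adjoint_iff_inner[OF assms])
next
  fix p q assume "p \<in> op_adjoint T" "q \<in> op_adjoint T"
  then show "p + q \<in> op_adjoint T"
    by (cases p; cases q) (auto simp: op_adjoint_iff_inner[OF assms] inner_add_left split: prod.splits)
next
  fix c p assume "p \<in> op_adjoint T"
  then show "c *\<^sub>R p \<in> op_adjoint T"
    by (cases p) (auto simp: op_adjoint_iff_inner[OF assms])
qed

lemma closed_op_adjoint:
  assumes "linear_op T"
  shows "closed (op_adjoint T)"
proof -
  have "op_adjoint T = (\<Inter>(x, v)\<in>T. {p. fst p \<bullet> v = snd p \<bullet> x})"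
    using op_adjoint_iff_inner[OF assms] by fastforce
  moreover have "closed {p :: 'b \<times> 'a. fst p \<bullet> v = snd p \<bullet> x}" for x v
    by (intro closed_Collect_eq continuous_intros)
  ultimately show ?thesis by auto
qed

text \<open>Von Neumann's argument: up to a swap and a sign, the graph of the adjoint is the
  orthogonal complement of the graph of \<open>T\<close>. A vector \<open>y\<close> orthogonal to
  the domain of the adjoint therefore satisfies \<open>(0, y) \<in> T\<close>, and \<open>T\<close>
  is single-valued.\<close>

lemma op_adjoint_dense:
  fixes T :: "('a::complex_hilbert_space, 'b::complex_hilbert_space) uop"
  assumes "linear_op T" "closed T"
  shows "closure (Domain (op_adjoint T)) = UNIV"
proof (rule subspace_dense_if_orthogonal_zero)
  show "subspace (Domain (op_adjoint T))"
    unfolding Domain_fst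
    by (intro linear_subspace_image subspace_op_adjoint assms bounded_linear.linear bounded_linear_fst)
next
  fix y assume y: "\<And>s. s \<in> Domain (op_adjoint T) \<Longrightarrow> y \<bullet> s = 0"
  have "(0, y) \<in> T"
  proof (rule ccontr)
    assume "(0, y) \<notin> T"
    then obtain p where p: "\<And>s. s \<in> T \<Longrightarrow> p \<bullet> s = 0" "p \<bullet> (0, y) \<noteq> 0"
      using orthogonal_separation[OF assms(2) linear_op_subspace[OF assms(1)]] by metis
    \<comment> \<open>Orthogonality of \<open>p\<close> to \<open>(x, v)\<close> reads
      \<open>snd p \<bullet> v = (- fst p) \<bullet> x\<close>.\<close>
    have "(snd p, - fst p) \<in> op_adjoint T"
      using p(1) by (auto simp: op_adjoint_iff_inner[OF assms(1)] inner_prod_def add_eq_0_iff)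
    then show False using y[of "snd p"] p(2) by (auto simp: inner_prod_def inner_commute)
  qed
  then show "y = 0" using assms(1) unfolding linear_op_def single_valued_def by blast
qed

section \<open>Self-adjoint operators shifted by a non-real number\<close>

lemma selfadjoint_op_lower_bound:
  assumes "selfadjoint_op H" "(x, y) \<in> H"
  shows "\<bar>Im z\<bar> * norm x \<le> norm (y - z *\<^sub>C x)"
proof -
  have lin: "linear_op H" and "op_adjoint H = H"
    using assms(1) unfolding selfadjoint_op_def by blast+
  then have "(x, y) \<in> op_adjoint H" using assms(2) by simp
  \<comment> \<open>Symmetry tested on the rotated pair, combined with \<open>skew\<close>, shows
    that the quadratic form of \<open>H\<close> is real.\<close>
  have "(\<i> *\<^sub>C x, \<i> *\<^sub>C y) \<in> H" using lin assms(2) unfolding linear_op_def by blast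
  then have "x \<bullet> \<i> *\<^sub>C y = y \<bullet> \<i> *\<^sub>C x"
    using \<open>(x, y) \<in> op_adjoint H\<close> op_adjoint_iff_inner[OF lin] by blast
  moreover have skew: "u \<bullet> \<i> *\<^sub>C v = - (v \<bullet> \<i> *\<^sub>C u)" for u v :: 'a
  proof -
    have "Im (cinner u v) = - Im (cinner v u)" by (subst cinner_commute) simp
    then show ?thesis by (simp add: Im_cinner)
  qed
  ultimately have "y \<bullet> \<i> *\<^sub>C x = 0" using skew[of x y] by linarith
  moreover have "x \<bullet> \<i> *\<^sub>C x = 0" using skew[of x x] by linarith
  \<comment> \<open>Pairing with the rotated \<open>x\<close> removes \<open>y\<close> and the real
    part of \<open>z\<close>, so only \<open>Im z\<close> survives; Cauchy-Schwarz then yields the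
    bound.\<close>
  ultimately have "(y - z *\<^sub>C x) \<bullet> \<i> *\<^sub>C x = - Im z * (norm x)\<^sup>2"
    by (simp add: scaleC_complex[of z] inner_diff_left inner_add_left norm_scaleC_i
        flip: power2_norm_eq_inner)
  then have "\<bar>Im z\<bar> * norm x * norm x \<le> norm (y - z *\<^sub>C x) * norm x"
    using Cauchy_Schwarz_ineq2[of "y - z *\<^sub>C x" "\<i> *\<^sub>C x"]
    by (simp add: norm_scaleC_i abs_mult power2_eq_square mult.assoc)
  then show ?thesis by (cases "x = 0") auto
qed

text \<open>The point obtained is the resolvent of \<open>H\<close> at \<open>z\<close> applied to
  \<open>h\<close>. The range \<open>S\<close> of \<open>H - z\<close> is closed by the lower bound,
  and a vector orthogonal to it solves the eigenvalue equation of \<open>H\<close> for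
  \<open>cnj z\<close>, so the lower bound at \<open>cnj z\<close> makes it zero.\<close>

lemma selfadjoint_op_shift_surjective:
  fixes H :: "('a::complex_hilbert_space, 'a) uop"
  assumes sa: "selfadjoint_op H" and z: "Im z \<noteq> 0"
  obtains x where "(x, h + z *\<^sub>C x) \<in> H"
proof -
  define S where "S = {y - z *\<^sub>C x | x y. (x, y) \<in> H}"
  have S_image: "S = (\<lambda>(x, y). y - z *\<^sub>C x) ` H" unfolding S_def by force
  have lin: "linear_op H" and adj: "op_adjoint H = H"
    using sa unfolding selfadjoint_op_def by blast+
  have "closed H" using closed_op_adjoint[OF lin] adj by simp
  have "linear (\<lambda>(x, y). y - z *\<^sub>C x :: 'a)"
    by (rule linearI) (auto simp: scaleC_add_right scaleC_scaleR scaleR_diff_right)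
  then have "subspace S"
    unfolding S_image using linear_op_subspace[OF lin] by (rule linear_subspace_image)
  have "closed S"
    unfolding closed_sequential_limits
  proof (intro allI impI, elim conjE)
    fix f r assume "\<forall>n. f n \<in> S" and lim: "f \<longlonglongrightarrow> r"
    then have "\<forall>n. \<exists>x y. (x, y) \<in> H \<and> f n = y - z *\<^sub>C x" unfolding S_def by blast
    then obtain X Y where XY: "\<And>n. (X n, Y n) \<in> H" "\<And>n. f n = Y n - z *\<^sub>C X n" by metis
    have bound: "\<bar>Im z\<bar> * dist (X m) (X n) \<le> dist (f m) (f n)" for m n
      using selfadjoint_op_lower_bound[OF sa linear_op_diff[OF lin XY(1)[of m] XY(1)[of n]], of z]
      by (simp add: dist_norm XY(2) scaleC_diff_right algebra_simps)
    have "Cauchy X"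
    proof (rule metric_CauchyI)
      fix e :: real assume "0 < e"
      then obtain M where "\<forall>m\<ge>M. \<forall>n\<ge>M. dist (f m) (f n) < \<bar>Im z\<bar> * e"
        using metric_CauchyD[OF LIMSEQ_imp_Cauchy[OF lim], of "\<bar>Im z\<bar> * e"] z by auto
      then have "\<forall>m\<ge>M. \<forall>n\<ge>M. \<bar>Im z\<bar> * dist (X m) (X n) < \<bar>Im z\<bar> * e"
        using bound order_le_less_trans by blast
      then show "\<exists>M. \<forall>m\<ge>M. \<forall>n\<ge>M. dist (X m) (X n) < e" using z by auto
    qed
    then obtain x where x: "X \<longlonglongrightarrow> x"
      using Cauchy_convergent convergent_def by blast
    \<comment> \<open>Convergence of \<open>f\<close> and \<open>X\<close> carries over to
      \<open>Y\<close>, so the graph points converge and closedness of \<open>H\<close>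
      applies.\<close>
    have "Y = (\<lambda>n. f n + z *\<^sub>C X n)" using XY(2) by auto
    then have "Y \<longlonglongrightarrow> r + z *\<^sub>C x" using lim x by (simp add: tendsto_intros)
    with x have "(\<lambda>n. (X n, Y n)) \<longlonglongrightarrow> (x, r + z *\<^sub>C x)" by (rule tendsto_Pair)
    with \<open>closed H\<close> XY(1) have "(x, r + z *\<^sub>C x) \<in> H" by (rule closed_sequentially)
    then show "r \<in> S" unfolding S_def by force
  qed
  have "h \<in> S"
  proof (rule ccontr)
    assume "h \<notin> S"
    then obtain w where w: "\<And>s. s \<in> S \<Longrightarrow> w \<bullet> s = 0" "w \<bullet> h \<noteq> 0"
      using orthogonal_separation[OF \<open>closed S\<close> \<open>subspace S\<close>] by metis
    have "w \<bullet> y = (cnj z *\<^sub>C w) \<bullet> x" if "(x, y) \<in> H" for x y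
      using w(1)[of "y - z *\<^sub>C x"] that unfolding S_def
      by (force simp: inner_diff_right simp flip: inner_scaleC)
    then have "(w, cnj z *\<^sub>C w) \<in> H"
      using op_adjoint_iff_inner[OF lin] adj by blast
    from selfadjoint_op_lower_bound[OF sa this, of "cnj z"] z have "w = 0"
      by (simp add: mult_le_0_iff)
    then show False using w(2) by simp
  qed
  then obtain x y where "(x, y) \<in> H" "h = y - z *\<^sub>C x" unfolding S_def by blast
  then have "(x, h + z *\<^sub>C x) \<in> H" by simp
  then show thesis by (rule that)
qed

lemma blinfun_eq_on_dense:
  fixes A B :: "'a::real_normed_vector \<Rightarrow>\<^sub>L 'b::real_normed_vector"
  assumes "closure S = UNIV" "\<And>x. x \<in> S \<Longrightarrow> A x = B x"
  shows "A = B"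
proof -
  have "closed {x. A x = B x}" by (intro closed_Collect_eq continuous_intros)
  then have "closure S \<subseteq> {x. A x = B x}" using assms(2) by (intro closure_minimal) auto
  then show ?thesis using assms(1) by (intro blinfun_eqI) auto
qed

section \<open>Perturbations on the common domain\<close>

context rigged_affine_space
begin

lemma affine_op_space_iff: "H \<in> affine_op_space F \<J> H0 \<longleftrightarrow> (\<exists>J\<in>\<J>. H = op_add H0 (rigged_op F J))"
  unfolding affine_op_space_def perturbation_space_def by auto

lemma rigged_op_unique:
  assumes "J \<in> \<J>" "(x, w) \<in> rigged_op F J" "(x, w') \<in> rigged_op F J"
  shows "w = w'"
  using V_selfadjoint[of "rigged_op F J"] assms
  unfolding perturbation_space_def selfadjoint_op_def linear_op_def single_valued_def by blast

lemma rigged_op_of_adjoint: "(x, k) \<in> F \<Longrightarrow> (blinfun_apply J k, w) \<in> op_adjoint F \<Longrightarrow> (x, w) \<in> rigged_op F J"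
  unfolding rigged_op_def rigged_product_def op_of_def
  by (rule subsetD[OF closure_subset]) blast

lemma adjoint_value_exists:
  assumes "J \<in> \<J>" "x \<in> \<D>" "(x, k) \<in> F"
  obtains w where "(J k, w) \<in> op_adjoint F"
proof -
  obtain k' w where "(x, k') \<in> F" "(J k', w) \<in> op_adjoint F"
    using domain_subset[OF assms(1)] assms(2) unfolding rigged_product_def op_of_def by blast
  moreover from this have "k' = k"
    using F_linear assms(3) unfolding linear_op_def single_valued_def by blast
  ultimately show thesis using that by blast
qed

text \<open>On \<open>\<D>\<close> the closure in \<open>rigged_op\<close> adds no values: the
  operator product already supplies one there, and self-adjointness makes the closure single-valued.
  Computations on \<open>\<D>\<close> thus reduce to the adjoint of \<open>F\<close>.\<close>

lemma rigged_op_iff: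
  assumes "J \<in> \<J>" "x \<in> \<D>" "(x, k) \<in> F"
  shows "(x, w) \<in> rigged_op F J \<longleftrightarrow> (J k, w) \<in> op_adjoint F"
  by (metis adjoint_value_exists assms rigged_op_of_adjoint rigged_op_unique)

lemma op_adjoint_lincomb:
  assumes "(u, w) \<in> op_adjoint F" "(u', w') \<in> op_adjoint F"
  shows "(a *\<^sub>R u + b *\<^sub>R u', a *\<^sub>R w + b *\<^sub>R w') \<in> op_adjoint F"
proof -
  note S = subspace_op_adjoint[OF F_linear]
  from subspace_add[OF S subspace_scale[OF S assms(1)] subspace_scale[OF S assms(2)]]
  show ?thesis by simp
qed

lemma domain_value:
  assumes "x \<in> \<D>"
  obtains k where "(x, k) \<in> F"
  using assms domain_subset_F by blast

text \<open>Shifting the operator becomes shifting its parameter, which keeps \<open>H + tV\<close>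
  in the affine space. Since closures of products need not add, the two graphs are compared
  pointwise: first components on either side lie in \<open>\<D>\<close>, where the values come from
  the adjoint of \<open>F\<close>.\<close>

lemma op_add_rigged_op:
  assumes "J0 \<in> \<J>" "J \<in> \<J>"
  shows "op_add (op_add H0 (rigged_op F J0)) (op_scaleR t (rigged_op F J))
    = op_add H0 (rigged_op F (J0 + t *\<^sub>R J))" (is "?L = ?R")
proof -
  have J1: "J0 + t *\<^sub>R J \<in> \<J>"
    using J_subspace assms by (intro subspace_add subspace_scale)
  have dom0: "x \<in> \<D>" if "(x, y) \<in> op_add H0 (rigged_op F J')" "J' \<in> \<J>" for x y J'
    using common_domain[of "op_add H0 (rigged_op F J')"] that affine_op_space_iff by blast
  have "p \<in> ?R" if L: "p \<in> ?L" for p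
  proof -
    from L obtain x y0 w0 w where p: "p = (x, y0 + w0 + t *\<^sub>R w)" and
      *: "(x, y0) \<in> H0" "(x, w0) \<in> rigged_op F J0" "(x, w) \<in> rigged_op F J"
      unfolding op_add_def op_scaleR_def by auto
    then have "x \<in> \<D>" using dom0[OF _ assms(1)] unfolding op_add_def by blast
    then obtain k where k: "(x, k) \<in> F" by (rule domain_value)
    have "((J0 + t *\<^sub>R J) k, w0 + t *\<^sub>R w) \<in> op_adjoint F"
      using op_adjoint_lincomb[of "J0 k" w0 "J k" w 1 t] * rigged_op_iff[OF _ \<open>x \<in> \<D>\<close> k] assms
      by (simp add: blinfun.add_left blinfun.scaleR_left)
    then have "(x, w0 + t *\<^sub>R w) \<in> rigged_op F (J0 + t *\<^sub>R J)" by (rule rigged_op_of_adjoint[OF k])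
    then show ?thesis using *(1) unfolding p op_add_def by (auto simp: add.assoc)
  qed
  moreover have "p \<in> ?L" if R: "p \<in> ?R" for p
  proof -
    from R obtain x y0 v where p: "p = (x, y0 + v)" and
      *: "(x, y0) \<in> H0" "(x, v) \<in> rigged_op F (J0 + t *\<^sub>R J)"
      unfolding op_add_def by auto
    then have "x \<in> \<D>" using dom0[OF _ J1] unfolding op_add_def by blast
    then obtain k where k: "(x, k) \<in> F" by (rule domain_value)
    obtain w0 where w0: "(J0 k, w0) \<in> op_adjoint F"
      using adjoint_value_exists[OF assms(1) \<open>x \<in> \<D>\<close> k] .
    obtain w where w: "(J k, w) \<in> op_adjoint F"
      using adjoint_value_exists[OF assms(2) \<open>x \<in> \<D>\<close> k] .
    have "((J0 + t *\<^sub>R J) k, w0 + t *\<^sub>R w) \<in> op_adjoint F"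
      using op_adjoint_lincomb[OF w0 w, of 1 t] by (simp add: blinfun.add_left blinfun.scaleR_left)
    then have "v = w0 + t *\<^sub>R w"
      using rigged_op_unique[OF J1 *(2)] rigged_op_of_adjoint[OF k] by blast
    moreover have "(x, w0) \<in> rigged_op F J0" "(x, w) \<in> rigged_op F J"
      using w0 w rigged_op_of_adjoint[OF k] by auto
    moreover from this have "(x, y0 + w0) \<in> op_add H0 (rigged_op F J0)"
      using *(1) unfolding op_add_def by blast
    moreover have "(x, t *\<^sub>R w) \<in> op_scaleR t (rigged_op F J)"
      using calculation unfolding op_scaleR_def by blast
    ultimately show ?thesis
      unfolding p op_add_def[of "op_add _ _"] by (auto simp: add.assoc[symmetric])
  qed
  ultimately show ?thesis by blast
qed

lemma affine_op_diff:
  assumes J: "J1 \<in> \<J>" "J2 \<in> \<J>" and y: "(x, y1) \<in> op_add H0 (rigged_op F J1)"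
    "(x, y2) \<in> op_add H0 (rigged_op F J2)" and k: "(x, k) \<in> F"
  shows "((J2 - J1) k, y2 - y1) \<in> op_adjoint F"
proof -
  have "op_add H0 (rigged_op F J1) \<in> affine_op_space F \<J> H0" using J(1) affine_op_space_iff by blast
  then have "x \<in> \<D>" and sv: "single_valued (op_add H0 (rigged_op F J1))"
    using common_domain H_selfadjoint y(1) unfolding selfadjoint_op_def linear_op_def by blast+
  from y obtain z1 w1 z2 w2 where *: "y1 = z1 + w1" "(x, z1) \<in> H0" "(x, w1) \<in> rigged_op F J1"
    "y2 = z2 + w2" "(x, z2) \<in> H0" "(x, w2) \<in> rigged_op F J2"
    unfolding op_add_def by blast
  \<comment> \<open>Single-valuedness is at hand for the sum, so \<open>w1\<close> is added to both
    candidate values of \<open>H0\<close> before they are compared.\<close>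
  then have "(x, z2 + w1) \<in> op_add H0 (rigged_op F J1)" unfolding op_add_def by blast
  then have "z2 = z1" using sv y(1) *(1) unfolding single_valued_def by force
  then show ?thesis
    using op_adjoint_lincomb[of "J2 k" w2 "J1 k" w1 1 "-1"] * rigged_op_iff[OF _ \<open>x \<in> \<D>\<close> k] J
    by (simp add: blinfun.diff_left)
qed

section \<open>The sandwiched resolvent and its second resolvent identity\<close>

lemma sandwiched_resolvent_pre_exists:
  assumes "H \<in> affine_op_space F \<J> H0" "Im z \<noteq> 0" "(w, h) \<in> op_adjoint F"
  obtains x k where "(x, h + z *\<^sub>C x) \<in> H" "(x, k) \<in> F" "(w, k) \<in> sandwiched_resolvent_pre F H z"
proof -
  obtain x where x: "(x, h + z *\<^sub>C x) \<in> H"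
    using selfadjoint_op_shift_surjective[OF H_selfadjoint[OF assms(1)] assms(2)] .
  then have "x \<in> \<D>" using common_domain[OF assms(1)] by blast
  then obtain k where k: "(x, k) \<in> F" by (rule domain_value)
  have "(h, x) \<in> op_resolvent H z" using x unfolding op_resolvent_def by force
  then show thesis using that x k assms(3) unfolding sandwiched_resolvent_pre_def by blast
qed

text \<open>Justifies the definite description: \<open>T_compact\<close> gives existence of the
  bounded extension, and two extensions agree on the dense domain of the adjoint of
  \<open>F\<close>, where the unextended product is everywhere defined.\<close>

lemma sandwiched_resolvent_eqI:
  assumes H: "H \<in> affine_op_space F \<J> H0" "Im z \<noteq> 0" and "(w, k) \<in> sandwiched_resolvent_pre F H z"
  shows "sandwiched_resolvent F H z w = k"
proof -
  obtain K where K: "sandwiched_resolvent_pre F H z \<subseteq> op_of K"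
    using T_compact[OF H] by blast
  have "K' = K" if K': "sandwiched_resolvent_pre F H z \<subseteq> op_of K'" for K'
  proof (rule blinfun_eq_on_dense[OF op_adjoint_dense[OF F_linear F_closed]])
    fix w assume "w \<in> Domain (op_adjoint F)"
    then obtain k where "(w, k) \<in> sandwiched_resolvent_pre F H z"
      using sandwiched_resolvent_pre_exists[OF H] by (metis DomainE)
    then show "K' w = K w" using K K' unfolding op_of_def by auto
  qed
  with K have "sandwiched_resolvent F H z = K"
    unfolding sandwiched_resolvent_def by (rule the_equality)
  moreover have "(w, k) \<in> op_of K" using K assms(3) by (rule subsetD)
  ultimately show ?thesis unfolding op_of_def by simp
qed

lemma sandwiched_resolvent_identity:
  assumes J: "J1 \<in> \<J>" "J2 \<in> \<J>" and z: "Im z \<noteq> 0"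
    and H1: "H1 = op_add H0 (rigged_op F J1)" and H2: "H2 = op_add H0 (rigged_op F J2)"
  shows "sandwiched_resolvent F H1 z u - sandwiched_resolvent F H2 z u
    = sandwiched_resolvent F H2 z ((J2 - J1) (sandwiched_resolvent F H1 z u))"
proof -
  let ?T1 = "sandwiched_resolvent F H1 z" and ?T2 = "sandwiched_resolvent F H2 z"
  have mem: "H1 \<in> affine_op_space F \<J> H0" "H2 \<in> affine_op_space F \<J> H0"
    using J H1 H2 affine_op_space_iff by blast+
  have lin: "linear_op H2" using H_selfadjoint[OF mem(2)] unfolding selfadjoint_op_def by blast
  have "?T1 - ?T2 = ?T2 o\<^sub>L (J2 - J1) o\<^sub>L ?T1"
  proof (rule blinfun_eq_on_dense[OF op_adjoint_dense[OF F_linear F_closed]])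
    fix w assume "w \<in> Domain (op_adjoint F)"
    then obtain h where h: "(w, h) \<in> op_adjoint F" by blast
    \<comment> \<open>Here \<open>x1\<close> and \<open>x2\<close> are the two resolvents applied to
      \<open>h\<close>, and \<open>k1\<close> and \<open>k2\<close> are the values of
      \<open>?T1\<close> and \<open>?T2\<close> at \<open>w\<close>.\<close>
    obtain x1 k1 where 1: "(x1, h + z *\<^sub>C x1) \<in> H1" "(x1, k1) \<in> F"
      "(w, k1) \<in> sandwiched_resolvent_pre F H1 z"
      using sandwiched_resolvent_pre_exists[OF mem(1) z h] .
    obtain x2 k2 where 2: "(x2, h + z *\<^sub>C x2) \<in> H2" "(x2, k2) \<in> F"
      "(w, k2) \<in> sandwiched_resolvent_pre F H2 z"
      using sandwiched_resolvent_pre_exists[OF mem(2) z h] .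
    obtain y where y: "(x1, y) \<in> H2"
      using 1(1) common_domain[OF mem(1)] common_domain[OF mem(2)] by blast
    \<comment> \<open>This is \<open>H2 x1 - H1 x1\<close>. It equals the adjoint of
      \<open>F\<close> at \<open>(J2 - J1) k1\<close>, so that vector lies in the domain on which
      \<open>?T2\<close> can be computed directly; the resolvent of \<open>H2\<close> sends
      \<open>?h\<close> to \<open>x1 - x2\<close>.\<close>
    let ?h = "y - (h + z *\<^sub>C x1)"
    have "((J2 - J1) k1, ?h) \<in> op_adjoint F"
      using affine_op_diff[OF J _ _ 1(2)] 1(1) y H1 H2 by blast
    moreover have "(?h, x1 - x2) \<in> op_resolvent H2 z"
    proof -
      have "?h = (y - (h + z *\<^sub>C x2)) - z *\<^sub>C (x1 - x2)" by (simp add: scaleC_diff_right)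
      then show ?thesis
        using linear_op_diff[OF lin y 2(1)] unfolding op_resolvent_def by blast
    qed
    moreover have "(x1 - x2, k1 - k2) \<in> F" using linear_op_diff[OF F_linear 1(2) 2(2)] .
    ultimately have "((J2 - J1) k1, k1 - k2) \<in> sandwiched_resolvent_pre F H2 z"
      unfolding sandwiched_resolvent_pre_def by blast
    then show "(?T1 - ?T2) w = (?T2 o\<^sub>L (J2 - J1) o\<^sub>L ?T1) w"
      using sandwiched_resolvent_eqI[OF mem(1) z 1(3)] sandwiched_resolvent_eqI[OF mem(2) z 2(3)]
        sandwiched_resolvent_eqI[OF mem(2) z]
      by (simp add: blinfun.diff_left)
  qed
  then have "(?T1 - ?T2) u = (?T2 o\<^sub>L (J2 - J1) o\<^sub>L ?T1) u" by simp
  then show ?thesis by (simp add: blinfun.diff_left)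
qed

lemma sandwiched_resolvent_limit_identity:
  assumes J: "J1 \<in> \<J>" "J2 \<in> \<J>"
    and H1: "H1 = op_add H0 (rigged_op F J1)" and H2: "H2 = op_add H0 (rigged_op F J2)"
    and reg: "regular_at F H1 l" "regular_at F H2 l"
  shows "sandwiched_resolvent_limit F H1 l u - sandwiched_resolvent_limit F H2 l u
    = sandwiched_resolvent_limit F H2 l ((J2 - J1) (sandwiched_resolvent_limit F H1 l u))"
proof -
  have lim: "((\<lambda>y. sandwiched_resolvent F H (Complex l y)) \<longlongrightarrow> sandwiched_resolvent_limit F H l) (at_right 0)"
    if reg_H: "regular_at F H l" for H
  proof -
    obtain L where L: "((\<lambda>y. sandwiched_resolvent F H (Complex l y)) \<longlongrightarrow> L) (at_right 0)"
      using reg_H unfolding regular_at_def regular_points_def by blast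
    then have "sandwiched_resolvent_limit F H l = L"
      unfolding sandwiched_resolvent_limit_def by (intro tendsto_Lim) auto
    with L show ?thesis by simp
  qed
  note lims = lim[OF reg(1)] lim[OF reg(2)]
  let ?A = "\<lambda>y. sandwiched_resolvent F H1 (Complex l y) u - sandwiched_resolvent F H2 (Complex l y) u"
  let ?B = "\<lambda>y. sandwiched_resolvent F H2 (Complex l y)
      ((J2 - J1) (sandwiched_resolvent F H1 (Complex l y) u))"
  have "(?A \<longlongrightarrow> sandwiched_resolvent_limit F H1 l u - sandwiched_resolvent_limit F H2 l u) (at_right 0)"
    by (intro tendsto_intros lims)
  then have "(?B \<longlongrightarrow> sandwiched_resolvent_limit F H1 l u - sandwiched_resolvent_limit F H2 l u) (at_right 0)"
  proof (rule Lim_transform_eventually)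
    \<comment> \<open>To the right of 0 the spectral parameter is non-real, as the resolvent
      identity requires.\<close>
    show "\<forall>\<^sub>F y in at_right 0. ?A y = ?B y"
      using eventually_at_right_less[of 0]
      by eventually_elim (intro sandwiched_resolvent_identity[OF J _ H1 H2], simp)
  qed
  \<comment> \<open>Operator and argument both vary with \<open>y\<close>; norm convergence of the
    operators makes the application jointly continuous.\<close>
  moreover have "(?B \<longlongrightarrow> sandwiched_resolvent_limit F H2 l
      ((J2 - J1) (sandwiched_resolvent_limit F H1 l u))) (at_right 0)"
    by (intro tendsto_intros lims)
  ultimately show ?thesis by (rule tendsto_unique[OF trivial_limit_at_right_real])
qed

section \<open>Comparison of the solution spaces\<close>

lemma Upsilon1_subset:
  assumes H: "H \<in> affine_op_space F \<J> H0" and J: "J \<in> \<J>" "J' \<in> \<J>"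
    and reg: "regular_at F (op_add H (op_scaleR t (rigged_op F J))) l"
      "regular_at F (op_add H (op_scaleR t' (rigged_op F J'))) l"
  shows "Upsilon1 F l H J t \<subseteq> Upsilon1 F l H J' t'"
proof
  let ?T = "sandwiched_resolvent_limit F (op_add H (op_scaleR t (rigged_op F J))) l"
  let ?T' = "sandwiched_resolvent_limit F (op_add H (op_scaleR t' (rigged_op F J'))) l"
  fix u assume "u \<in> Upsilon1 F l H J t"
  \<comment> \<open>With \<open>t\<close> moved inside, the resolvent identity at
    \<open>t *\<^sub>R J u\<close> has \<open>u\<close> itself as the inner value on its right-hand
    side.\<close>
  then have u: "?T (t *\<^sub>R J u) = u" unfolding Upsilon1_def by (simp add: blinfun.scaleR_right)
  obtain J0 where J0: "J0 \<in> \<J>" "H = op_add H0 (rigged_op F J0)"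
    using H affine_op_space_iff by blast
  have mem: "J0 + t *\<^sub>R J \<in> \<J>" "J0 + t' *\<^sub>R J' \<in> \<J>"
    using J_subspace J0(1) J by (auto intro!: subspace_add subspace_scale)
  have "?T (t *\<^sub>R J u) - ?T' (t *\<^sub>R J u)
      = ?T' (((J0 + t' *\<^sub>R J') - (J0 + t *\<^sub>R J)) (?T (t *\<^sub>R J u)))"
    using sandwiched_resolvent_limit_identity[OF mem _ _ reg] op_add_rigged_op[OF J0(1)] J J0(2)
    by blast
  moreover have "((J0 + t' *\<^sub>R J') - (J0 + t *\<^sub>R J)) u = t' *\<^sub>R J' u - t *\<^sub>R J u"
    by (simp add: blinfun.diff_left blinfun.scaleR_left)
  ultimately have "u - ?T' (t *\<^sub>R J u) = ?T' (t' *\<^sub>R J' u) - ?T' (t *\<^sub>R J u)"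
    by (simp only: u blinfun.diff_right)
  \<comment> \<open>The term \<open>?T' (t *\<^sub>R J u)\<close> occurs on both sides and cancels,
    which leaves the equation for the second direction.\<close>
  then have "u = ?T' (t' *\<^sub>R J' u)" by (simp only: diff_conv_add_uminus add_right_cancel)
  then have "u - t' *\<^sub>R ?T' (J' u) = 0" by (simp only: blinfun.scaleR_right right_minus_eq)
  then show "u \<in> Upsilon1 F l H J' t'" unfolding Upsilon1_def by (rule CollectI)
qed

end

theorem theorem1p26:
  fixes F :: "('h::complex_hilbert_space, 'k::complex_hilbert_space) uop"
    and \<J> :: "('k \<Rightarrow>\<^sub>L 'k) set"
    and H0 H V V' :: "('h, 'h) uop"
    and \<D> :: "'h set"
    and l :: real
  assumes "rigged_affine_space F \<J> H0 \<D>"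
    and "l \<in> essentially_regular_points F \<J> H0"
    and "H \<in> affine_op_space F \<J> H0"
    and "resonant_at F H l"
    and "V \<in> perturbation_space F \<J>" and "regularizing_direction F H l V"
    and "V' \<in> perturbation_space F \<J>" and "regularizing_direction F H l V'"
  shows "\<forall>J \<in> \<J>. \<forall>J' \<in> \<J>. \<forall>t t'.
      V = rigged_op F J \<longrightarrow> V' = rigged_op F J' \<longrightarrow>
      regular_at F (op_add H (op_scaleR t V)) l \<longrightarrow>
      regular_at F (op_add H (op_scaleR t' V')) l \<longrightarrow>
      Upsilon1 F l H J t = Upsilon1 F l H J' t'"
proof -
  interpret rigged_affine_space F \<J> H0 \<D> by fact
  show ?thesis
  proof (intro ballI allI impI equalityI)
    fix J J' t t'
    assume J: "J \<in> \<J>" "J' \<in> \<J>" and V: "V = rigged_op F J" "V' = rigged_op F J'"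
      and reg: "regular_at F (op_add H (op_scaleR t V)) l" "regular_at F (op_add H (op_scaleR t' V')) l"
    note reg' = reg[unfolded V]
    \<comment> \<open>The inclusion is symmetric in the two pairs, so exchanging them gives the
      converse. The case \<open>V = V'\<close> contains the independence of \<open>J\<close> and
      \<open>t\<close>.\<close>
    show "Upsilon1 F l H J t \<subseteq> Upsilon1 F l H J' t'"
      by (rule Upsilon1_subset[OF assms(3) J reg'])
    show "Upsilon1 F l H J' t' \<subseteq> Upsilon1 F l H J t"
      by (rule Upsilon1_subset[OF assms(3) J(2,1) reg'(2,1)])
  qed
qed

end
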